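(* Let $\Gamma=(\pi,\mathcal{C},\Sigma)$ be a concrete data type definition and $\mathcal{E}$ a finite set of equations between terms of sort $\pi$ such that $\mathcal{E}_{AC}=\emptyset$ and $\mathcal{E}$ has a complete presentation $\mathcal{R}$. Then the family of construction functions $\mathcal{F}(\mathcal{R})$ is valid with respect to $\mathcal{E}$, whatever the order in which the non-default clauses of each $f_C$ are listed.
   Context: Fix primitive sorts $\mathcal{S}_0$ and primitive constants $\mathcal{C}_0$. A concrete data type definition is $\Gamma=(\pi,\mathcal{C},\Sigma)$ with $\pi\notin\mathcal{S}_0$, $\mathcal{C}$ a non-empty set of constructors, and profiles $C:\sigma_1\ldots\sigma_n\pi$ with $\sigma_i\in\mathcal{S}_0\cup\{\pi\}$. $\mathcal{T}_\sigma$ is the set of variable-free terms of sort $\sigma$ over $\mathcal{C}_0\cup\mathcal{C}$. $=_\mathcal{E}$ is the smallest congruence containing $\mathcal{E}$ (closed under substitution and contexts). A family of construction functions is $(f_C)$ with $f_C:\mathcal{T}_{\sigma_1}\times\cdots\times\mathcal{T}_{\sigma_n}\to\mathcal{T}_\pi$; values: $\mathrm{Val}(\sigma)=\mathcal{T}_\sigma$ for primitive $\sigma$, and $\mathrm{Val}(\pi)$ is the smallest set containing $f_C(v_1,\ldots,v_n)$ for all $C$ and $v_i\in\mathrm{Val}(\sigma_i)$. The family is valid w.r.t. $\mathcal{E}$ if (correctness) $f_C(v_1,\ldots,v_n)=_\mathcal{E}C(v_1,\ldots,v_n)$ for all $C$ and values $v_i$, and (completeness) $C(v_1,\ldots,v_n)=_\mathcal{E}D(w_1,\ldots,w_p)$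 with $v_i,w_j$ values implies $f_C(v_1,\ldots,v_n)=f_D(w_1,\ldots,w_p)$ syntactically. $\mathcal{E}_{AC}$ is the set of equations of $\mathcal{E}$ that are commutativity equations $C(x,y)=C(y,x)$ or associativity equations for commutative constructors; here it is assumed empty. In that case, "$\mathcal{E}$ has complete presentation $\mathcal{R}$" means $\mathcal{R}$ is a finite set of rewrite rules $l\to r$ contained in a reduction ordering (a well-founded order on terms stable under contexts and substitutions), the rewrite relation $\to_\mathcal{R}$ (rewriting a subterm $l\theta$ into $r\theta$) is confluent, and $=_\mathcal{E}$ coincides with the congruence generated by $\mathcal{R}$. Definition of $\mathcal{F}(\mathcal{R})=(f_C)_{C\in\mathcal{C}}$: each $f_C$ is defined by an ordered list of pattern-matching clauses, evaluated by taking the first clause whose pattern matches the arguments and whose guard holds. For every rule $l\to r\in\mathcal{R}$ with $l=C(l_1,\ldots,l_n)$, $f_C$ has a clause whose pattern is $(\mathrm{lin}(l_1),\ldots,\mathrm{lin}(l_n))$, where $\mathrm{lin}$ replaces each variable occurrence (variable position) in $l$ by a distinct fresh variable via an injective map $\rho$ from variable positions of $l$ to variables; whose guard $Eq(l)$ is the conjunction of true and of all equalities $\rho(p)=\rho(q)$ for variable positions $p,q$ of $l$ carrying the same variable (syntactic equality of the matched values); and whose body is $\widehat{\mathrm{lin}(r)}$, i.e. $r$ with each variable replaced by the corresponding fresh variable of $\mathrm{lin}(l)$ and every occurrence of a constructor $D$ replaced by a call to its construction function $f_D$. The definition of $f_C$ ends with the default clause returning $C(x_1,\ldots,x_n)$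 on arguments $x_1,\ldots,x_n$. *)

theory Defs
  imports Main "HOL-Library.Confluence"
begin

section \<open>Concrete data types, sorts and terms\<close>

(* Con is the application of a constructor of the defined type, Prim a primitive constant. *)
datatype (vars: 'v, prims: 'k, constrs_of: 'c) trm =
  Var 'v | Prim 'k | Con 'c "('v, 'k, 'c) trm list"

(* A variable carries its sort, so every sort has infinitely many variables. *)
type_synonym 's var = "nat \<times> 's"
type_synonym ('s, 'k, 'c) sterm = "('s var, 'k, 'c) trm"
type_synonym ('s, 'k, 'c) rule = "('s, 'k, 'c) sterm \<times> ('s, 'k, 'c) sterm"

(* The triple (\<pi>, \<C>, \<Sigma>) together with the primitive sorts and constants it is built on.
   profile C = [\<sigma>\<^sub>1, ..., \<sigma>\<^sub>n] stands for the profile C : \<sigma>\<^sub>1 ... \<sigma>\<^sub>n \<pi>; the result sort is implicit. *)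
record ('s, 'k, 'c) cdt =
  prim_sorts :: "'s set"
  prim_consts :: "'k set"
  const_sort :: "'k \<Rightarrow> 's"
  cdt_sort :: 's
  constructors :: "'c set"
  profile :: "'c \<Rightarrow> 's list"

definition sorts :: "('s, 'k, 'c) cdt \<Rightarrow> 's set" where
  "sorts \<Gamma> = insert (cdt_sort \<Gamma>) (prim_sorts \<Gamma>)"

definition cdt_definition :: "('s, 'k, 'c) cdt \<Rightarrow> bool" where
  "cdt_definition \<Gamma> \<longleftrightarrow>
     const_sort \<Gamma> ` prim_consts \<Gamma> \<subseteq> prim_sorts \<Gamma> \<and>
     cdt_sort \<Gamma> \<notin> prim_sorts \<Gamma> \<and>
     constructors \<Gamma> \<noteq> {} \<and>
     (\<forall>C \<in> constructors \<Gamma>. set (profile \<Gamma> C) \<subseteq> sorts \<Gamma>)"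

inductive has_sort :: "('s, 'k, 'c) cdt \<Rightarrow> ('s, 'k, 'c) sterm \<Rightarrow> 's \<Rightarrow> bool" for \<Gamma> where
  var: "\<sigma> \<in> sorts \<Gamma> \<Longrightarrow> has_sort \<Gamma> (Var (n, \<sigma>)) \<sigma>"
| prim: "k \<in> prim_consts \<Gamma> \<Longrightarrow> has_sort \<Gamma> (Prim k) (const_sort \<Gamma> k)"
| con: "C \<in> constructors \<Gamma> \<Longrightarrow> list_all2 (has_sort \<Gamma>) ts (profile \<Gamma> C) \<Longrightarrow>
    has_sort \<Gamma> (Con C ts) (cdt_sort \<Gamma>)"

definition well_sorted :: "('s, 'k, 'c) cdt \<Rightarrow> ('s, 'k, 'c) sterm set" where
  "well_sorted \<Gamma> = {t. \<exists>\<sigma>. has_sort \<Gamma> t \<sigma>}"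

definition ground_terms :: "('s, 'k, 'c) cdt \<Rightarrow> 's \<Rightarrow> ('s, 'k, 'c) sterm set" where
  "ground_terms \<Gamma> \<sigma> = {t. has_sort \<Gamma> t \<sigma> \<and> vars t = {}}"

primrec subst :: "('v \<Rightarrow> ('w, 'k, 'c) trm) \<Rightarrow> ('v, 'k, 'c) trm \<Rightarrow> ('w, 'k, 'c) trm" where
  "subst \<theta> (Var x) = \<theta> x"
| "subst \<theta> (Prim k) = Prim k"
| "subst \<theta> (Con C ts) = Con C (map (subst \<theta>) ts)"

definition sorted_subst :: "('s, 'k, 'c) cdt \<Rightarrow> ('s var \<Rightarrow> ('s, 'k, 'c) sterm) \<Rightarrow> bool" where
  "sorted_subst \<Gamma> \<theta> \<longleftrightarrow> (\<forall>n. \<forall>\<sigma> \<in> sorts \<Gamma>. has_sort \<Gamma> (\<theta> (n, \<sigma>)) \<sigma>)"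


section \<open>Equational theories and rewriting\<close>

inductive eq_theory ::
    "('s, 'k, 'c) cdt \<Rightarrow> ('s, 'k, 'c) rule set \<Rightarrow> ('s, 'k, 'c) sterm \<Rightarrow> ('s, 'k, 'c) sterm \<Rightarrow> bool"
  for \<Gamma> E where
  ax: "(s, t) \<in> E \<Longrightarrow> sorted_subst \<Gamma> \<theta> \<Longrightarrow> eq_theory \<Gamma> E (subst \<theta> s) (subst \<theta> t)"
| refl: "t \<in> well_sorted \<Gamma> \<Longrightarrow> eq_theory \<Gamma> E t t"
| sym: "eq_theory \<Gamma> E s t \<Longrightarrow> eq_theory \<Gamma> E t s"
| trans: "eq_theory \<Gamma> E s t \<Longrightarrow> eq_theory \<Gamma> E t u \<Longrightarrow> eq_theory \<Gamma> E s u"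
| ctxt: "eq_theory \<Gamma> E s t \<Longrightarrow>
    Con C (us @ s # vs) \<in> well_sorted \<Gamma> \<Longrightarrow> Con C (us @ t # vs) \<in> well_sorted \<Gamma> \<Longrightarrow>
    eq_theory \<Gamma> E (Con C (us @ s # vs)) (Con C (us @ t # vs))"

inductive rewrite_step ::
    "('s, 'k, 'c) cdt \<Rightarrow> ('s, 'k, 'c) rule set \<Rightarrow> ('s, 'k, 'c) sterm \<Rightarrow> ('s, 'k, 'c) sterm \<Rightarrow> bool"
  for \<Gamma> R where
  root: "(l, r) \<in> R \<Longrightarrow> sorted_subst \<Gamma> \<theta> \<Longrightarrow> rewrite_step \<Gamma> R (subst \<theta> l) (subst \<theta> r)"
| ctxt: "rewrite_step \<Gamma> R s t \<Longrightarrow>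
    Con C (us @ s # vs) \<in> well_sorted \<Gamma> \<Longrightarrow> Con C (us @ t # vs) \<in> well_sorted \<Gamma> \<Longrightarrow>
    rewrite_step \<Gamma> R (Con C (us @ s # vs)) (Con C (us @ t # vs))"

(* (s, t) \<in> gt means s > t; irreflexivity follows from well-foundedness. *)
definition reduction_ordering ::
    "('s, 'k, 'c) cdt \<Rightarrow> (('s, 'k, 'c) sterm \<times> ('s, 'k, 'c) sterm) set \<Rightarrow> bool" where
  "reduction_ordering \<Gamma> gt \<longleftrightarrow>
     gt \<subseteq> well_sorted \<Gamma> \<times> well_sorted \<Gamma> \<and> trans gt \<and> wf (gt\<inverse>) \<and>
     (\<forall>s t \<theta>. (s, t) \<in> gt \<longrightarrow> sorted_subst \<Gamma> \<theta> \<longrightarrow> (subst \<theta> s, subst \<theta> t) \<in> gt) \<and>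
     (\<forall>s t C us vs. (s, t) \<in> gt \<longrightarrow>
        Con C (us @ s # vs) \<in> well_sorted \<Gamma> \<longrightarrow> Con C (us @ t # vs) \<in> well_sorted \<Gamma> \<longrightarrow>
        (Con C (us @ s # vs), Con C (us @ t # vs)) \<in> gt)"

(* The usual convention on rewrite rules that r has no variable outside l is part of the notion:
   without it the body of the clause built from l \<rightarrow> r would contain unbound variables. *)
definition rewrite_rule :: "('s, 'k, 'c) cdt \<Rightarrow> ('s, 'k, 'c) rule \<Rightarrow> bool" where
  "rewrite_rule \<Gamma> = (\<lambda>(l, r). (\<exists>\<sigma>. has_sort \<Gamma> l \<sigma> \<and> has_sort \<Gamma> r \<sigma>) \<and> vars r \<subseteq> vars l)"

(* Complete presentation in the case where there are no AC equations. *)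
definition complete_presentation ::
    "('s, 'k, 'c) cdt \<Rightarrow> ('s, 'k, 'c) rule set \<Rightarrow> ('s, 'k, 'c) rule set \<Rightarrow> bool" where
  "complete_presentation \<Gamma> E R \<longleftrightarrow>
     finite R \<and> (\<forall>lr \<in> R. rewrite_rule \<Gamma> lr) \<and>
     (\<exists>gt. reduction_ordering \<Gamma> gt \<and> R \<subseteq> gt) \<and>
     confluentp (rewrite_step \<Gamma> R) \<and>
     eq_theory \<Gamma> E = eq_theory \<Gamma> R"

definition commutativity_eq :: "'c \<Rightarrow> ('s, 'k, 'c) rule \<Rightarrow> bool" where
  "commutativity_eq C e \<longleftrightarrow>
     (\<exists>x y. x \<noteq> y \<and> e = (Con C [Var x, Var y], Con C [Var y, Var x]))"

definition associativity_eq :: "'c \<Rightarrow> ('s, 'k, 'c) rule \<Rightarrow> bool" where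
  "associativity_eq C e \<longleftrightarrow>
     (\<exists>x y z s t. distinct [x, y, z] \<and>
        s = Con C [Con C [Var x, Var y], Var z] \<and> t = Con C [Var x, Con C [Var y, Var z]] \<and>
        (e = (s, t) \<or> e = (t, s)))"

definition AC_equations :: "('s, 'k, 'c) rule set \<Rightarrow> ('s, 'k, 'c) rule set" where
  "AC_equations E =
     {e \<in> E. \<exists>C. commutativity_eq C e \<or> ((\<exists>e' \<in> E. commutativity_eq C e') \<and> associativity_eq C e)}"


section \<open>Families of construction functions and their validity\<close>

definition arguments :: "('s, 'k, 'c) cdt \<Rightarrow> ('s \<Rightarrow> ('s, 'k, 'c) sterm set) \<Rightarrow> 'c
    \<Rightarrow> ('s, 'k, 'c) sterm list set" where
  "arguments \<Gamma> A C = {ts. list_all2 (\<lambda>t \<sigma>. t \<in> A \<sigma>) ts (profile \<Gamma> C)}"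

type_synonym ('s, 'k, 'c) family = "'c \<Rightarrow> ('s, 'k, 'c) sterm list \<Rightarrow> ('s, 'k, 'c) sterm"

definition construction_functions :: "('s, 'k, 'c) cdt \<Rightarrow> ('s, 'k, 'c) family \<Rightarrow> bool" where
  "construction_functions \<Gamma> f \<longleftrightarrow>
     (\<forall>C \<in> constructors \<Gamma>. \<forall>ts \<in> arguments \<Gamma> (ground_terms \<Gamma>) C.
        f C ts \<in> ground_terms \<Gamma> (cdt_sort \<Gamma>))"

inductive is_val :: "('s, 'k, 'c) cdt \<Rightarrow> ('s, 'k, 'c) family \<Rightarrow> 's \<Rightarrow> ('s, 'k, 'c) sterm \<Rightarrow> bool"
  for \<Gamma> f where
  prim: "\<sigma> \<in> prim_sorts \<Gamma> \<Longrightarrow> t \<in> ground_terms \<Gamma> \<sigma> \<Longrightarrow> is_val \<Gamma> f \<sigma> t"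
| con: "C \<in> constructors \<Gamma> \<Longrightarrow> list_all2 (\<lambda>v \<sigma>. is_val \<Gamma> f \<sigma> v) vs (profile \<Gamma> C) \<Longrightarrow>
    is_val \<Gamma> f (cdt_sort \<Gamma>) (f C vs)"

definition Val :: "('s, 'k, 'c) cdt \<Rightarrow> ('s, 'k, 'c) family \<Rightarrow> 's \<Rightarrow> ('s, 'k, 'c) sterm set" where
  "Val \<Gamma> f \<sigma> = {v. is_val \<Gamma> f \<sigma> v}"

definition valid :: "('s, 'k, 'c) cdt \<Rightarrow> ('s, 'k, 'c) rule set \<Rightarrow> ('s, 'k, 'c) family \<Rightarrow> bool" where
  "valid \<Gamma> E f \<longleftrightarrow>
     (\<forall>C \<in> constructors \<Gamma>. \<forall>vs \<in> arguments \<Gamma> (Val \<Gamma> f) C.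
        eq_theory \<Gamma> E (f C vs) (Con C vs)) \<and>
     (\<forall>C \<in> constructors \<Gamma>. \<forall>D \<in> constructors \<Gamma>.
        \<forall>vs \<in> arguments \<Gamma> (Val \<Gamma> f) C. \<forall>ws \<in> arguments \<Gamma> (Val \<Gamma> f) D.
          eq_theory \<Gamma> E (Con C vs) (Con D ws) \<longrightarrow> f C vs = f D ws)"


section \<open>Pattern-matching programs\<close>

(* Clause bodies: Call C es calls the construction function of C, Build C es applies C itself. *)
datatype ('v, 'k, 'c) expr =
  EVar 'v | EPrim 'k | Build 'c "('v, 'k, 'c) expr list" | Call 'c "('v, 'k, 'c) expr list"

(* The guard is the conjunction of the equalities x = y for (x, y) in the given set. *)
record ('s, 'k, 'c) clause =
  patterns :: "('s, 'k, 'c) sterm list"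
  guard :: "('s var \<times> 's var) set"
  body :: "('s var, 'k, 'c) expr"

type_synonym ('s, 'k, 'c) program = "'c \<Rightarrow> ('s, 'k, 'c) clause list"

definition fires :: "('s, 'k, 'c) clause \<Rightarrow> ('s, 'k, 'c) sterm list
    \<Rightarrow> ('s var \<Rightarrow> ('s, 'k, 'c) sterm) \<Rightarrow> bool" where
  "fires cl ts \<theta> \<longleftrightarrow> map (subst \<theta>) (patterns cl) = ts \<and> (\<forall>(x, y) \<in> guard cl. \<theta> x = \<theta> y)"

(* Call-by-value big-step semantics: evaluates P \<theta> e t means that e evaluates to t in the
   environment \<theta>, and returns P C ts t that the function of C applied to ts returns t. *)
inductive evaluates :: "('s, 'k, 'c) program \<Rightarrow> ('s var \<Rightarrow> ('s, 'k, 'c) sterm)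
    \<Rightarrow> ('s var, 'k, 'c) expr \<Rightarrow> ('s, 'k, 'c) sterm \<Rightarrow> bool"
  and returns :: "('s, 'k, 'c) program \<Rightarrow> 'c \<Rightarrow> ('s, 'k, 'c) sterm list
    \<Rightarrow> ('s, 'k, 'c) sterm \<Rightarrow> bool"
  for P where
  EVar: "evaluates P \<theta> (EVar x) (\<theta> x)"
| EPrim: "evaluates P \<theta> (EPrim k) (Prim k)"
| Build: "list_all2 (evaluates P \<theta>) es ts \<Longrightarrow> evaluates P \<theta> (Build C es) (Con C ts)"
| Call: "list_all2 (evaluates P \<theta>) es ts \<Longrightarrow> returns P C ts t \<Longrightarrow> evaluates P \<theta> (Call C es) t"
| first_clause: "i < length (P C) \<Longrightarrow> fires (P C ! i) ts \<theta> \<Longrightarrow>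
    (\<forall>j < i. \<nexists>\<theta>'. fires (P C ! j) ts \<theta>') \<Longrightarrow>
    evaluates P \<theta> (body (P C ! i)) t \<Longrightarrow> returns P C ts t"

definition terminating :: "('s, 'k, 'c) cdt \<Rightarrow> ('s, 'k, 'c) program \<Rightarrow> bool" where
  "terminating \<Gamma> P \<longleftrightarrow>
     (\<forall>C \<in> constructors \<Gamma>. \<forall>ts \<in> arguments \<Gamma> (ground_terms \<Gamma>) C. \<exists>!t. returns P C ts t)"

(* Meaningful only where the program returns a result. *)
definition family_of :: "('s, 'k, 'c) program \<Rightarrow> ('s, 'k, 'c) family" where
  "family_of P C ts = (THE t. returns P C ts t)"


section \<open>The program generated by a rewrite system\<close>

fun var_at :: "('v, 'k, 'c) trm \<Rightarrow> nat list \<Rightarrow> 'v option" where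
  "var_at (Var x) [] = Some x"
| "var_at (Con C ts) (i # p) = (if i < length ts then var_at (ts ! i) p else None)"
| "var_at _ _ = None"

definition var_positions :: "('v, 'k, 'c) trm \<Rightarrow> nat list set" where
  "var_positions t = {p. var_at t p \<noteq> None}"

function lin :: "(nat list \<Rightarrow> 'w) \<Rightarrow> ('v, 'k, 'c) trm \<Rightarrow> ('w, 'k, 'c) trm" where
  "lin \<rho> (Var x) = Var (\<rho> [])"
| "lin \<rho> (Prim k) = Prim k"
| "lin \<rho> (Con C ts) = Con C (map (\<lambda>i. lin (\<lambda>p. \<rho> (i # p)) (ts ! i)) [0..<length ts])"
  by pat_completeness auto
termination
  by (relation "measure (size \<circ> snd)") (auto simp: less_Suc_eq_le size_list_estimation'[OF nth_mem order_refl])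

primrec call_constructors :: "('v, 'k, 'c) trm \<Rightarrow> ('v, 'k, 'c) expr" where
  "call_constructors (Var x) = EVar x"
| "call_constructors (Prim k) = EPrim k"
| "call_constructors (Con C ts) = Call C (map call_constructors ts)"

(* A variable x of r may occur several times in l; \<kappa> x selects the occurrence whose fresh variable
   replaces x in the body (the guard makes the choice irrelevant). *)
definition rule_clause :: "('s, 'k, 'c) rule \<Rightarrow> ('s, 'k, 'c) clause \<Rightarrow> bool" where
  "rule_clause = (\<lambda>(l, r) cl. \<exists>\<rho> \<kappa>.
     inj_on \<rho> (var_positions l) \<and>
     (\<forall>p x. var_at l p = Some x \<longrightarrow> snd (\<rho> p) = snd x) \<and>
     (\<forall>x \<in> vars l. var_at l (\<kappa> x) = Some x) \<and>
     (\<exists>C. lin \<rho> l = Con C (patterns cl)) \<and>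
     guard cl = {(\<rho> p, \<rho> q) | p q. \<exists>x. var_at l p = Some x \<and> var_at l q = Some x} \<and>
     body cl = call_constructors (subst (\<lambda>x. Var (\<rho> (\<kappa> x))) r))"

definition default_clause :: "('s, 'k, 'c) cdt \<Rightarrow> 'c \<Rightarrow> ('s, 'k, 'c) clause" where
  "default_clause \<Gamma> C =
     (let xs = enumerate 0 (profile \<Gamma> C)
      in \<lparr>patterns = map Var xs, guard = {}, body = Build C (map EVar xs)\<rparr>)"

(* P is one of the programs for F(R): the order of the rules, the fresh variables and the
   occurrences selected in the bodies are arbitrary. *)
definition generated_program ::
    "('s, 'k, 'c) cdt \<Rightarrow> ('s, 'k, 'c) rule set \<Rightarrow> ('s, 'k, 'c) program \<Rightarrow> bool" where
  "generated_program \<Gamma> R P \<longleftrightarrow>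
     (\<forall>C \<in> constructors \<Gamma>. \<exists>rs cls.
        distinct rs \<and> set rs = {(l, r) \<in> R. \<exists>ls. l = Con C ls} \<and>
        list_all2 rule_clause rs cls \<and>
        P C = cls @ [default_clause \<Gamma> C])"

end

theory Submission
  imports Defs
begin

text \<open>
  An application \<open>f\<^sub>C ts\<close> whose clause for \<open>l \<rightarrow> r\<close> fires rewrites \<open>C(ts)\<close> at the root and then
  re-evaluates every constructor of the instance of \<open>r\<close>, innermost first. Each recursive call is thus
  made on a subterm of a proper reduct of \<open>C(ts)\<close>, and this order is well-founded
  because rewriting terminates. Induction along this order shows that \<open>f\<^sub>C ts\<close> is a reduct of \<open>C(ts)\<close>,
  and that it is in normal form if the arguments are: the default clause is reached only if no
  rule applies at the root. Values are therefore normal forms, correctness is immediate, and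
  completeness is uniqueness of normal forms. Since the equations of \<open>E\<close> relate terms of the defined
  sort only, \<open>R\<close> has no rule for a primitive constant, so every rule does yield a clause.
\<close>

section \<open>Sorts and substitutions\<close>

lemma has_sort_Var_iff [simp]: "has_sort \<Gamma> (Var x) \<sigma> \<longleftrightarrow> \<sigma> = snd x \<and> \<sigma> \<in> sorts \<Gamma>"
  by (cases x) (auto elim: has_sort.cases intro: has_sort.intros)

lemma has_sort_Prim_iff [simp]: "has_sort \<Gamma> (Prim k) \<sigma> \<longleftrightarrow> \<sigma> = const_sort \<Gamma> k \<and> k \<in> prim_consts \<Gamma>"
  by (auto elim: has_sort.cases intro: has_sort.intros)

lemma has_sort_Con_iff [simp]:
  "has_sort \<Gamma> (Con C ts) \<sigma> \<longleftrightarrow>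
     \<sigma> = cdt_sort \<Gamma> \<and> C \<in> constructors \<Gamma> \<and> list_all2 (has_sort \<Gamma>) ts (profile \<Gamma> C)"
  by (auto elim: has_sort.cases intro: has_sort.intros)

lemma has_sort_unique: "has_sort \<Gamma> t \<sigma> \<Longrightarrow> has_sort \<Gamma> t \<tau> \<Longrightarrow> \<sigma> = \<tau>"
  by (cases t) auto

lemma sorted_substD: "sorted_subst \<Gamma> \<theta> \<Longrightarrow> snd x \<in> sorts \<Gamma> \<Longrightarrow> has_sort \<Gamma> (\<theta> x) (snd x)"
  by (cases x) (auto simp: sorted_subst_def)

lemma has_sort_subst: "has_sort \<Gamma> t \<sigma> \<Longrightarrow> sorted_subst \<Gamma> \<theta> \<Longrightarrow> has_sort \<Gamma> (subst \<theta> t) \<sigma>"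
proof (induction t arbitrary: \<sigma>)
  case (Con C ts)
  then show ?case by (auto simp: list_all2_conv_all_nth)
qed (auto simp: sorted_substD)

text \<open>The \<open>profile\<close> fixes the sort of each argument position, so both sort
  derivations can be followed down to \<open>x\<close>. Thus a matcher of a well-sorted term is
  well-sorted on the variables of the pattern.\<close>

lemma has_sort_subst_var:
  "has_sort \<Gamma> t \<sigma> \<Longrightarrow> has_sort \<Gamma> (subst \<theta> t) \<sigma> \<Longrightarrow> x \<in> vars t \<Longrightarrow> has_sort \<Gamma> (\<theta> x) (snd x)"
proof (induction t arbitrary: \<sigma>)
  case (Con C ts)
  then obtain i where i: "i < length ts" "x \<in> vars (ts ! i)"
    by (auto simp: in_set_conv_nth)
  with Con.prems have "has_sort \<Gamma> (ts ! i) (profile \<Gamma> C ! i)"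
      "has_sort \<Gamma> (subst \<theta> (ts ! i)) (profile \<Gamma> C ! i)"
    by (auto simp: list_all2_conv_all_nth)
  with i Con.IH show ?case by (meson nth_mem)
qed auto

lemma well_sorted_Con_replace:
  assumes "Con C (us @ s # vs) \<in> well_sorted \<Gamma>" "has_sort \<Gamma> s \<sigma>" "has_sort \<Gamma> t \<sigma>"
  shows "Con C (us @ t # vs) \<in> well_sorted \<Gamma>"
proof -
  have "has_sort \<Gamma> s \<tau> \<Longrightarrow> has_sort \<Gamma> t \<tau>" for \<tau>
    using assms(2,3) has_sort_unique by metis
  then show ?thesis
    using assms(1) by (fastforce simp: well_sorted_def list_all2_append1 list_all2_Cons1)
qed

lemma vars_subst: "vars (subst \<theta> t) = (\<Union>x \<in> vars t. vars (\<theta> x))"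
  by (induction t) auto

lemma subst_eqD: "subst \<theta> t = subst \<eta> t \<Longrightarrow> x \<in> vars t \<Longrightarrow> \<theta> x = \<eta> x"
  by (induction t) auto

lemma subst_Var [simp]: "subst Var t = t"
  by (induction t) (auto intro: map_idI)

section \<open>Linearization\<close>

lemma vars_iff_var_at: "x \<in> vars t \<longleftrightarrow> (\<exists>p. var_at t p = Some x)"
proof
  show "x \<in> vars t \<Longrightarrow> \<exists>p. var_at t p = Some x"
  proof (induction t)
    case (Var y)
    then show ?case by (auto intro: exI[of _ "[]"])
  next
    case (Con C ts)
    then obtain i p where "i < length ts" "var_at (ts ! i) p = Some x"
      by (fastforce simp: in_set_conv_nth)
    then show ?case by (auto intro!: exI[of _ "i # p"])
  qed auto
  have "var_at t p = Some x \<Longrightarrow> x \<in> vars t" for p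
    by (induction t p rule: var_at.induct) (auto split: if_splits)
  then show "\<exists>p. var_at t p = Some x \<Longrightarrow> x \<in> vars t" by blast
qed

text \<open>Giving one value to all fresh variables that stem from the same variable undoes the
  linearization. Used both to fire a clause on an instance of \<open>l\<close> and to recover an
  instance of \<open>l\<close> from a firing clause.\<close>

lemma subst_lin:
  "(\<And>p x. var_at t p = Some x \<Longrightarrow> \<theta> (\<rho> p) = \<eta> x) \<Longrightarrow> subst \<theta> (lin \<rho> t) = subst \<eta> t"
proof (induction \<rho> t rule: lin.induct)
  case (3 \<rho> C ts)
  have "subst \<theta> (lin (\<lambda>p. \<rho> (i # p)) (ts ! i)) = subst \<eta> (ts ! i)" if "i < length ts" for i
    using that by (intro "3.IH") (auto intro: "3.prems")
  then show ?case by (auto intro!: nth_equalityI)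
qed auto

lemma var_at_in_vars_lin: "var_at t p = Some x \<Longrightarrow> \<rho> p \<in> vars (lin \<rho> t)"
proof (induction t p arbitrary: \<rho> rule: var_at.induct)
  case (2 C ts i p)
  then show ?case by (auto split: if_splits intro!: bexI[of _ i])
qed auto

section \<open>Subterms\<close>

inductive subterm :: "('v, 'k, 'c) trm \<Rightarrow> ('v, 'k, 'c) trm \<Rightarrow> bool" where
  refl: "subterm t t"
| Con: "subterm a s \<Longrightarrow> subterm a (Con C (us @ s # vs))"

lemma subterm_trans: "subterm b c \<Longrightarrow> subterm a b \<Longrightarrow> subterm a c"
  by (induction rule: subterm.induct) (auto intro: subterm.intros)

lemma subterm_arg: "t \<in> set ts \<Longrightarrow> subterm t (Con C ts)"
  by (metis split_list subterm.intros)

lemma subterm_subst_var: "x \<in> vars t \<Longrightarrow> subterm (\<theta> x) (subst \<theta> t)"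
proof (induction t)
  case (Con C ts)
  then obtain t where t: "t \<in> set ts" "subterm (\<theta> x) (subst \<theta> t)" by auto
  then have "subterm (subst \<theta> t) (subst \<theta> (Con C ts))" by (auto intro: subterm_arg)
  then show ?case using t(2) by (rule subterm_trans)
qed (auto intro: subterm.intros)

section \<open>Rewriting with sorted rules\<close>

locale rewriting =
  fixes \<Gamma> :: "('s, 'k, 'c) cdt" and R :: "('s, 'k, 'c) rule set"
  assumes rules: "lr \<in> R \<Longrightarrow> rewrite_rule \<Gamma> lr"
begin

abbreviation step where "step \<equiv> rewrite_step \<Gamma> R"
abbreviation steps where "steps \<equiv> step\<^sup>*\<^sup>*"

definition nf :: "('s, 'k, 'c) sterm \<Rightarrow> bool" where "nf t \<longleftrightarrow> (\<nexists>u. step t u)"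

section \<open>Sorts and variables under rewriting\<close>

lemma step_sort: "step s t \<Longrightarrow> \<exists>\<sigma>. has_sort \<Gamma> s \<sigma> \<and> has_sort \<Gamma> t \<sigma>"
proof (induction rule: rewrite_step.induct)
  case (root l r \<theta>)
  then show ?case using rules[OF root(1)] by (auto simp: rewrite_rule_def dest: has_sort_subst)
qed (auto simp: well_sorted_def)

lemma step_well_sorted: "step s t \<Longrightarrow> s \<in> well_sorted \<Gamma> \<and> t \<in> well_sorted \<Gamma>"
  using step_sort by (auto simp: well_sorted_def)

lemma tranclp_step_well_sorted: "step\<^sup>+\<^sup>+ s t \<Longrightarrow> t \<in> well_sorted \<Gamma>"
  by (induction rule: tranclp_induct) (auto dest: step_well_sorted)

lemma steps_sort: "steps s t \<Longrightarrow> has_sort \<Gamma> s \<sigma> \<Longrightarrow> has_sort \<Gamma> t \<sigma>"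
  by (induction rule: rtranclp_induct) (auto dest: step_sort has_sort_unique)

lemma step_vars: "step s t \<Longrightarrow> vars t \<subseteq> vars s"
proof (induction rule: rewrite_step.induct)
  case (root l r \<theta>)
  then show ?case using rules[OF root(1)] by (auto simp: rewrite_rule_def vars_subst)
qed auto

lemma steps_vars: "steps s t \<Longrightarrow> vars t \<subseteq> vars s"
  by (induction rule: rtranclp_induct) (auto dest: step_vars)

lemma steps_ground: "steps s t \<Longrightarrow> s \<in> ground_terms \<Gamma> \<sigma> \<Longrightarrow> t \<in> ground_terms \<Gamma> \<sigma>"
  using steps_sort steps_vars by (fastforce simp: ground_terms_def)

section \<open>Reductions in contexts and subterms\<close>

lemma step_ctxt:
  assumes "step s t" "Con C (us @ s # vs) \<in> well_sorted \<Gamma>"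
  shows "step (Con C (us @ s # vs)) (Con C (us @ t # vs))"
  using assms step_sort[OF assms(1)] well_sorted_Con_replace rewrite_step.ctxt by metis

lemma steps_ctxt:
  assumes "steps s t" "Con C (us @ s # vs) \<in> well_sorted \<Gamma>"
  shows "steps (Con C (us @ s # vs)) (Con C (us @ t # vs)) \<and> Con C (us @ t # vs) \<in> well_sorted \<Gamma>"
  using assms
  by (induction rule: rtranclp_induct)
    (auto intro: rtranclp.rtrancl_into_rtrancl dest: step_ctxt step_well_sorted)

text \<open>Arguments are reduced from left to right; the generalized prefix \<open>us\<close>
  collects those already reduced.\<close>

lemma steps_args:
  assumes "list_all2 steps ss ts" "Con C (us @ ss) \<in> well_sorted \<Gamma>"
  shows "steps (Con C (us @ ss)) (Con C (us @ ts))"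
  using assms
proof (induction arbitrary: us rule: list_all2_induct)
  case (Cons s ss t ts)
  from steps_ctxt[OF Cons(1) Cons.prems]
  have "steps (Con C (us @ s # ss)) (Con C (us @ t # ss))" "Con C ((us @ [t]) @ ss) \<in> well_sorted \<Gamma>"
    by auto
  with Cons.IH[of "us @ [t]"] show ?case by auto
qed auto

lemma step_subterm:
  "subterm b t \<Longrightarrow> step b b' \<Longrightarrow> t \<in> well_sorted \<Gamma> \<Longrightarrow> \<exists>t'. step t t' \<and> subterm b' t'"
proof (induction rule: subterm.induct)
  case (Con a s C us vs)
  then have "s \<in> well_sorted \<Gamma>"
    by (auto simp: well_sorted_def list_all2_append1 list_all2_Cons1)
  with Con obtain t' where "step s t'" "subterm b' t'" by blast
  with Con step_ctxt show ?case by (meson subterm.Con)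
qed (auto intro: subterm.intros)

lemma steps_subterm:
  assumes "steps b b'" "subterm b t" "t \<in> well_sorted \<Gamma>"
  shows "\<exists>t'. steps t t' \<and> subterm b' t' \<and> t' \<in> well_sorted \<Gamma>"
  using assms
proof (induction rule: rtranclp_induct)
  case (step y z)
  then show ?case
    by (meson rtranclp.rtrancl_into_rtrancl step_subterm step_well_sorted)
qed auto

lemma nf_subterm: "subterm a t \<Longrightarrow> t \<in> well_sorted \<Gamma> \<Longrightarrow> nf t \<Longrightarrow> nf a"
  unfolding nf_def using step_subterm by blast

lemma nf_steps: "steps t u \<Longrightarrow> nf t \<Longrightarrow> u = t"
  by (auto simp: nf_def elim: converse_rtranclpE)

text \<open>The recursive calls made while evaluating \<open>b\<close> are on terms \<open>a\<close> with \<open>below a b\<close>.\<close>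

definition below :: "('s, 'k, 'c) sterm \<Rightarrow> ('s, 'k, 'c) sterm \<Rightarrow> bool" where
  "below a b \<longleftrightarrow> (\<exists>b'. step\<^sup>+\<^sup>+ b b' \<and> subterm a b')"

lemma below_subterm: "below b c \<Longrightarrow> subterm a b \<Longrightarrow> below a c"
  by (auto simp: below_def intro: subterm_trans)

text \<open>Evaluating the arguments of a pending call keeps it below \<open>c\<close>: the
  reduction of \<open>b\<close> lifts to the reduct of \<open>c\<close> around it.\<close>

lemma below_steps: "below b c \<Longrightarrow> steps b b' \<Longrightarrow> below b' c"
proof -
  assume "below b c" and steps: "steps b b'"
  then obtain c' where c': "step\<^sup>+\<^sup>+ c c'" "subterm b c'" by (auto simp: below_def)
  then have "c' \<in> well_sorted \<Gamma>" using tranclp_step_well_sorted by blast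
  with steps_subterm[OF steps c'(2)] obtain c'' where "steps c' c''" "subterm b' c''" by blast
  with tranclp_rtranclp_tranclp[OF c'(1)] show "below b' c" unfolding below_def by blast
qed

lemma wfp_below:
  assumes "wfp step\<inverse>\<inverse>"
  shows "wfp below"
proof -
  \<comment> \<open>A descent from a subterm \<open>b\<close> of \<open>t\<close> to
    \<open>a\<close> lifts to a proper reduct of \<open>t\<close> that contains \<open>a\<close>.
    Hence the induction is on \<open>t\<close> along reduction, with \<open>b\<close> ranging over
    all subterms.\<close>
  have acc: "t \<in> well_sorted \<Gamma> \<Longrightarrow> subterm b t \<Longrightarrow> Wellfounded.accp below b" for t b
    using wfp_tranclp[OF assms]
  proof (induction t arbitrary: b rule: wfp_induct_rule)
    case (less t)
    show ?case
    proof (rule accpI)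
      fix a assume "below a b"
      then obtain b1 b2 where b: "step b b1" "steps b1 b2" "subterm a b2"
        by (auto simp: below_def dest: tranclpD)
      obtain t1 where t1: "step t t1" "subterm b1 t1"
        using step_subterm[OF less.prems(2) b(1) less.prems(1)] by blast
      obtain t2 where t2: "steps t1 t2" "subterm b2 t2" "t2 \<in> well_sorted \<Gamma>"
        using steps_subterm[OF b(2) t1(2)] step_well_sorted[OF t1(1)] by blast
      have "(step\<inverse>\<inverse>)\<^sup>+\<^sup>+ t2 t"
        using t1(1) t2(1) by (simp add: tranclp_converse rtranclp_into_tranclp2)
      then show "Wellfounded.accp below a"
        using less.IH t2 b(3) subterm_trans by blast
    qed
  qed
  \<comment> \<open>Proper reducts are well-sorted whatever \<open>b\<close> is, so
    \<open>acc\<close> covers everything below \<open>b\<close>.\<close>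
  have "Wellfounded.accp below b" for b
  proof (rule accpI)
    fix a assume "below a b"
    then obtain b' where b': "step\<^sup>+\<^sup>+ b b'" "subterm a b'" by (auto simp: below_def)
    then have "b' \<in> well_sorted \<Gamma>" using tranclp_step_well_sorted by blast
    with b' acc show "Wellfounded.accp below a" by blast
  qed
  then show ?thesis using accp_wfpI by blast
qed

section \<open>Equational theory and joinability\<close>

lemma eq_theory_step: "step s t \<Longrightarrow> eq_theory \<Gamma> R s t"
  by (induction rule: rewrite_step.induct) (auto intro: eq_theory.intros)

lemma eq_theory_steps:
  assumes "steps s t" "s \<in> well_sorted \<Gamma>"
  shows "eq_theory \<Gamma> R s t"
  using assms(1)
proof (induction rule: rtranclp_induct)
  case base
  show ?case using assms(2) by (rule eq_theory.refl)
next
  case (step y z)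
  then show ?case using eq_theory_step eq_theory.trans by blast
qed

text \<open>The Church-Rosser property: confluence closes the peak at the middle term of a
  transitivity, and contexts carry over both reductions.\<close>

lemma eq_theory_joinable:
  assumes confl: "confluentp step" and "eq_theory \<Gamma> R s t"
  shows "\<exists>u. steps s u \<and> steps t u"
  using assms(2)
proof (induction rule: eq_theory.induct)
  case (ax s t \<theta>)
  then show ?case by (meson r_into_rtranclp rewrite_step.root rtranclp.rtrancl_refl)
next
  case (trans s t u)
  then obtain v w where vw: "steps s v" "steps t v" "steps t w" "steps u w" by blast
  with confluentpD[OF confl vw(2,3)] show ?case by (meson rtranclp_trans)
next
  case (ctxt s t C us vs)
  then show ?case using steps_ctxt by meson
qed auto

end

section \<open>Evaluation of the generated program\<close>

text \<open>Constructor-headed left-hand sides ensure that every rule yields a clause;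
  \<open>complete_presentation_lhs_Con\<close> derives this from the sorts of
  \<open>E\<close>.\<close>

locale generated = rewriting \<Gamma> R
  for \<Gamma> :: "('s, 'k, 'c) cdt" and R :: "('s, 'k, 'c) rule set" +
  fixes P :: "('s, 'k, 'c) program"
  assumes lhs_Con: "(l, r) \<in> R \<Longrightarrow> \<exists>C ls. l = Con C ls"
    and wfp_step: "wfp step\<inverse>\<inverse>"
    and program: "generated_program \<Gamma> R P"
begin

lemma nf_Prim: "nf (Prim k)"
proof -
  have "\<not> step s u" if "s = Prim k" for s u
  proof
    assume "step s u"
    then show False using that
      by (induction rule: rewrite_step.induct) (auto dest: lhs_Con)
  qed
  then show ?thesis by (auto simp: nf_def)
qed

text \<open>Invariant of the main induction. The first conjunct packs existence and uniqueness of
  the result. Normality is conditional because termination concerns all ground arguments, while the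
  default clause leaves its arguments as they are.\<close>

definition evaluates_calls :: "'c \<Rightarrow> ('s, 'k, 'c) sterm list \<Rightarrow> ('s, 'k, 'c) sterm \<Rightarrow> bool" where
  "evaluates_calls C ts u \<longleftrightarrow>
     (\<forall>u'. returns P C ts u' \<longleftrightarrow> u' = u) \<and> steps (Con C ts) u \<and> ((\<forall>t \<in> set ts. nf t) \<longrightarrow> nf u)"

lemma evaluates_EVar_iff: "evaluates P \<theta> (EVar x) t \<longleftrightarrow> t = \<theta> x"
  by (subst evaluates.simps) auto

lemma evaluates_EPrim_iff: "evaluates P \<theta> (EPrim k) t \<longleftrightarrow> t = Prim k"
  by (subst evaluates.simps) auto

lemma evaluates_Build_iff:
  "evaluates P \<theta> (Build C es) t \<longleftrightarrow> (\<exists>ts. list_all2 (evaluates P \<theta>) es ts \<and> t = Con C ts)"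
  by (subst evaluates.simps) auto

lemma evaluates_Call_iff:
  "evaluates P \<theta> (Call C es) t \<longleftrightarrow> (\<exists>ts. list_all2 (evaluates P \<theta>) es ts \<and> returns P C ts t)"
  by (subst evaluates.simps) auto

lemma list_all2_functional: "list_all2 (\<lambda>x y. y = f x) xs ys \<longleftrightarrow> ys = map f xs"
  by (auto simp: list_all2_conv_all_nth intro: nth_equalityI)

text \<open>Innermost evaluation of an instance of a right-hand side, with \<open>IH\<close>
  supplying the calls; \<open>y\<close> sends rule variables to fresh ones. The result
  \<open>u\<close> is chosen before the environment, since a firing clause fixes
  \<open>\<theta>\<close> only on its pattern variables.\<close>

lemma evaluates_body:
  assumes IH: "\<And>D us. below (Con D us) b \<Longrightarrow> Con D us \<in> ground_terms \<Gamma> (cdt_sort \<Gamma>)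
      \<Longrightarrow> \<exists>u. evaluates_calls D us u"
    and "below (subst \<eta> t) b" "subst \<eta> t \<in> ground_terms \<Gamma> \<sigma>"
  shows "\<exists>u. (\<forall>\<theta>. (\<forall>x \<in> vars t. \<theta> (y x) = \<eta> x) \<longrightarrow>
          (\<forall>u'. evaluates P \<theta> (call_constructors (subst (\<lambda>x. Var (y x)) t)) u' \<longleftrightarrow> u' = u)) \<and>
        steps (subst \<eta> t) u \<and> ((\<forall>x \<in> vars t. nf (\<eta> x)) \<longrightarrow> nf u)"
  using assms(2,3)
proof (induction t arbitrary: \<sigma>)
  case (Var x)
  then show ?case by (auto simp: evaluates_EVar_iff)
next
  case (Prim k)
  then show ?case by (auto simp: evaluates_EPrim_iff nf_Prim)
next
  case (Con C ts)
  let ?e = "\<lambda>t. call_constructors (subst (\<lambda>x. Var (y x)) t)"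
  let ?Q = "\<lambda>t u. (\<forall>\<theta>. (\<forall>x \<in> vars t. \<theta> (y x) = \<eta> x) \<longrightarrow>
          (\<forall>u'. evaluates P \<theta> (?e t) u' \<longleftrightarrow> u' = u)) \<and>
        steps (subst \<eta> t) u \<and> ((\<forall>x \<in> vars t. nf (\<eta> x)) \<longrightarrow> nf u)"
  have "\<exists>u. ?Q t u" if t: "t \<in> set ts" for t
  proof -
    have "below (subst \<eta> t) b"
      using below_subterm[OF Con.prems(1)] t by (simp add: subterm_arg)
    moreover have "\<exists>\<tau>. subst \<eta> t \<in> ground_terms \<Gamma> \<tau>"
      using Con.prems(2) t
      by (fastforce simp: ground_terms_def list_all2_conv_all_nth in_set_conv_nth)
    ultimately show ?thesis using Con.IH[OF t] by blast
  qed
  then have "\<exists>g. \<forall>t \<in> set ts. ?Q t (g t)" by (intro bchoice ballI)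
  then obtain g where "\<forall>t \<in> set ts. ?Q t (g t)" ..
  note g = bspec[OF this]
  have steps: "steps (Con C (map (subst \<eta>) ts)) (Con C (map g ts))"
  proof -
    have "list_all2 steps (map (subst \<eta>) ts) (map g ts)"
      unfolding list_all2_map1 list_all2_map2 list_all2_same using g by blast
    moreover have "Con C ([] @ map (subst \<eta>) ts) \<in> well_sorted \<Gamma>"
      using Con.prems(2) unfolding ground_terms_def well_sorted_def by auto
    ultimately show ?thesis using steps_args[of _ _ C "[]"] by simp
  qed
  have sort: "\<sigma> = cdt_sort \<Gamma>" using Con.prems(2) by (simp add: ground_terms_def)
  \<comment> \<open>The call is made on the evaluated arguments; the resulting term is a reduct of
    \<open>subst \<eta> (Con C ts)\<close> and so still below \<open>b\<close>.\<close>
  have "below (Con C (map g ts)) b" using below_steps[OF _ steps] Con.prems(1) by simp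
  moreover have "Con C (map g ts) \<in> ground_terms \<Gamma> (cdt_sort \<Gamma>)"
    using steps_ground[OF steps] Con.prems(2) sort by simp
  ultimately obtain u where u: "evaluates_calls C (map g ts) u" using IH by blast
  have "evaluates P \<theta> (?e (Con C ts)) u' \<longleftrightarrow> u' = u"
    if \<theta>: "\<forall>x \<in> vars (Con C ts). \<theta> (y x) = \<eta> x" for \<theta> u'
  proof -
    have "list_all2 (evaluates P \<theta>) (map ?e ts) us \<longleftrightarrow> us = map g ts" for us
    proof -
      have e: "evaluates P \<theta> (?e t) u' \<longleftrightarrow> u' = g t" if "t \<in> set ts" for t u'
      proof -
        have "\<forall>x \<in> vars t. \<theta> (y x) = \<eta> x" using \<theta> that by simp
        then show ?thesis using g[OF that] by blast
      qed
      have "list_all2 (evaluates P \<theta>) (map ?e ts) us \<longleftrightarrow> list_all2 (\<lambda>t u. u = g t) ts us"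
        unfolding list_all2_map1 by (rule list.rel_cong[OF HOL.refl HOL.refl e])
      then show ?thesis by (simp add: list_all2_functional)
    qed
    then show ?thesis using u by (simp add: evaluates_Call_iff evaluates_calls_def comp_def)
  qed
  moreover have "steps (subst \<eta> (Con C ts)) u"
    using rtranclp_trans[OF steps] u by (simp add: evaluates_calls_def)
  moreover have "nf u" if "\<forall>x \<in> vars (Con C ts). nf (\<eta> x)"
  proof -
    have "nf (g t)" if "t \<in> set ts" for t
    proof -
      have "\<forall>x \<in> vars t. nf (\<eta> x)" using \<open>\<forall>x \<in> vars (Con C ts). nf (\<eta> x)\<close> that by simp
      then show ?thesis using g[OF that] by blast
    qed
    then show ?thesis using u by (simp add: evaluates_calls_def)
  qed
  ultimately show ?case by (intro exI[of _ u] conjI allI impI)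
qed

text \<open>Pattern and guard together accept every instance of \<open>l\<close>, so the default
  clause is reached only if no rule applies at the root.\<close>

lemma rule_clause_fires:
  assumes "rule_clause (l, r) cl" "subst \<eta> l = Con C ts"
  shows "\<exists>\<theta>. fires cl ts \<theta>"
proof -
  from assms(1) obtain \<rho> D where \<rho>: "inj_on \<rho> (var_positions l)" "lin \<rho> l = Con D (patterns cl)"
      "guard cl = {(\<rho> p, \<rho> q) | p q. \<exists>x. var_at l p = Some x \<and> var_at l q = Some x}"
    by (auto simp: rule_clause_def)
  \<comment> \<open>By injectivity each fresh variable is traced back to its position in
    \<open>l\<close> and takes the value of the variable standing there. Other variables get an
    arbitrary value: they occur in neither patterns nor guard.\<close>
  define \<theta> where "\<theta> z = \<eta> (the (var_at l (inv_into (var_positions l) \<rho> z)))" for z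
  have \<theta>: "\<theta> (\<rho> p) = \<eta> x" if "var_at l p = Some x" for p x
    using that \<rho>(1) by (simp add: \<theta>_def var_positions_def)
  have "subst \<theta> (lin \<rho> l) = subst \<eta> l" using \<theta> by (rule subst_lin)
  then have "map (subst \<theta>) (patterns cl) = ts" using assms(2) \<rho>(2) by simp
  moreover have "\<theta> z = \<theta> w" if "(z, w) \<in> guard cl" for z w
    using that \<theta> \<rho>(3) by auto
  ultimately show ?thesis by (auto simp: fires_def)
qed

text \<open>Each pattern variable is an argument index paired with a sort, so \<open>fst\<close>
  recovers the index.\<close>

lemma default_clause_fires:
  assumes "length ts = length (profile \<Gamma> C)"
  shows "fires (default_clause \<Gamma> C) ts (\<lambda>x. ts ! fst x)"
  using assms by (auto simp: fires_def default_clause_def Let_def nth_enumerate_eq intro: nth_equalityI)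

lemma default_clause_evaluates:
  assumes "fires (default_clause \<Gamma> C) ts \<theta>"
  shows "evaluates P \<theta> (body (default_clause \<Gamma> C)) u \<longleftrightarrow> u = Con C ts"
proof -
  have ts: "ts = map \<theta> (enumerate 0 (profile \<Gamma> C))"
    using assms by (auto simp: fires_def default_clause_def Let_def)
  show ?thesis
    by (simp add: ts default_clause_def Let_def evaluates_Build_iff list_all2_map1
        evaluates_EVar_iff list_all2_functional)
qed

text \<open>A firing clause is a root step from \<open>Con C ts\<close> to an instance of
  \<open>r\<close>; the body evaluates that instance, which lies below
  \<open>Con C ts\<close>.\<close>

lemma evaluates_rule_clause:
  assumes IH: "\<And>D us. below (Con D us) (Con C ts) \<Longrightarrow> Con D us \<in> ground_terms \<Gamma> (cdt_sort \<Gamma>)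
      \<Longrightarrow> \<exists>u. evaluates_calls D us u"
    and ground: "Con C ts \<in> ground_terms \<Gamma> (cdt_sort \<Gamma>)"
    and rule: "(l, r) \<in> R" "l = Con C ls" "rule_clause (l, r) cl"
    and fires: "fires cl ts \<theta>\<^sub>0"
  shows "\<exists>u. (\<forall>\<theta>. fires cl ts \<theta> \<longrightarrow> (\<forall>u'. evaluates P \<theta> (body cl) u' \<longleftrightarrow> u' = u)) \<and>
      steps (Con C ts) u \<and> ((\<forall>t \<in> set ts. nf t) \<longrightarrow> nf u)"
proof -
  obtain \<rho> \<kappa> D where
      \<kappa>: "\<forall>x \<in> vars l. var_at l (\<kappa> x) = Some x"
    and lin: "lin \<rho> l = Con D (patterns cl)"
    and guard: "guard cl = {(\<rho> p, \<rho> q) | p q. \<exists>x. var_at l p = Some x \<and> var_at l q = Some x}"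
    and body: "body cl = call_constructors (subst (\<lambda>x. Var (\<rho> (\<kappa> x))) r)"
    using rule(3) unfolding rule_clause_def prod.case by - (elim exE conjE, rule that)
  have "D = C" using lin rule(2) by simp
  obtain \<sigma> where \<sigma>: "has_sort \<Gamma> l \<sigma>" "has_sort \<Gamma> r \<sigma>" and vars_r: "vars r \<subseteq> vars l"
    using rules[OF rule(1)] by (auto simp: rewrite_rule_def)
  have [simp]: "\<sigma> = cdt_sort \<Gamma>" using \<sigma>(1) rule(2) by simp
  \<comment> \<open>The value of \<open>x\<close> is read at the occurrence selected by
    \<open>\<kappa>\<close>. Outside \<open>l\<close>, \<open>\<eta>\<close> is the identity, to be
    well-sorted on all variables as \<open>sorted_subst\<close> demands.\<close>
  define \<eta> where "\<eta> x = (if x \<in> vars l then \<theta>\<^sub>0 (\<rho> (\<kappa> x)) else Var x)" for x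
  have "\<theta>\<^sub>0 (\<rho> p) = \<eta> x" if p: "var_at l p = Some x" for p x
  proof -
    have x: "x \<in> vars l" using p vars_iff_var_at by metis
    \<comment> \<open>The guard makes every occurrence of \<open>x\<close> agree with the selected
      one.\<close>
    then have "(\<rho> p, \<rho> (\<kappa> x)) \<in> guard cl" unfolding guard using p \<kappa> by blast
    then show ?thesis using fires x by (auto simp: fires_def \<eta>_def)
  qed
  then have "subst \<theta>\<^sub>0 (lin \<rho> l) = subst \<eta> l" by (rule subst_lin)
  then have l\<eta>: "subst \<eta> l = Con C ts" using fires lin \<open>D = C\<close> by (simp add: fires_def)
  have sorted: "sorted_subst \<Gamma> \<eta>"
  proof -
    have "has_sort \<Gamma> (\<eta> x) (snd x)" if "x \<in> vars l" for x
      using has_sort_subst_var[OF \<sigma>(1) _ that] l\<eta> ground by (simp add: ground_terms_def)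
    then show ?thesis by (force simp: sorted_subst_def \<eta>_def)
  qed
  have step: "step (Con C ts) (subst \<eta> r)"
    using rewrite_step.root[OF rule(1) sorted] l\<eta> by simp
  have "below (subst \<eta> r) (Con C ts)"
    using step by (auto simp: below_def intro: subterm.refl)
  moreover have "subst \<eta> r \<in> ground_terms \<Gamma> (cdt_sort \<Gamma>)"
    using steps_ground ground step by blast
  ultimately have "\<exists>u. (\<forall>\<theta>. (\<forall>x \<in> vars r. \<theta> (\<rho> (\<kappa> x)) = \<eta> x) \<longrightarrow>
         (\<forall>u'. evaluates P \<theta> (body cl) u' \<longleftrightarrow> u' = u)) \<and>
       steps (subst \<eta> r) u \<and> ((\<forall>x \<in> vars r. nf (\<eta> x)) \<longrightarrow> nf u)"
    unfolding body by (rule evaluates_body[rotated 1]) (rule IH)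
  then obtain u where u: "(\<forall>\<theta>. (\<forall>x \<in> vars r. \<theta> (\<rho> (\<kappa> x)) = \<eta> x) \<longrightarrow>
         (\<forall>u'. evaluates P \<theta> (body cl) u' \<longleftrightarrow> u' = u)) \<and>
       steps (subst \<eta> r) u \<and> ((\<forall>x \<in> vars r. nf (\<eta> x)) \<longrightarrow> nf u)" ..
  \<comment> \<open>Two matchers of the same arguments may differ off the patterns, but the fresh
    variables of the body all occur in the patterns.\<close>
  have "evaluates P \<theta> (body cl) u' \<longleftrightarrow> u' = u" if \<theta>: "fires cl ts \<theta>" for \<theta> u'
  proof (rule u[THEN conjunct1, rule_format])
    fix x assume x: "x \<in> vars r"
    have "subst \<theta> (lin \<rho> l) = subst \<theta>\<^sub>0 (lin \<rho> l)"
      using \<theta> fires lin by (simp add: fires_def)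
    moreover have "\<rho> (\<kappa> x) \<in> vars (lin \<rho> l)"
      by (rule var_at_in_vars_lin[OF bspec[OF \<kappa> subsetD[OF vars_r x]]])
    ultimately have "\<theta> (\<rho> (\<kappa> x)) = \<theta>\<^sub>0 (\<rho> (\<kappa> x))" by (rule subst_eqD)
    then show "\<theta> (\<rho> (\<kappa> x)) = \<eta> x" using x vars_r by (auto simp: \<eta>_def)
  qed
  moreover have "steps (Con C ts) u"
    using step u[THEN conjunct2, THEN conjunct1] by (rule converse_rtranclp_into_rtranclp)
  moreover have "nf u" if nf: "\<forall>t \<in> set ts. nf t"
  proof (rule u[THEN conjunct2, THEN conjunct2, rule_format])
    fix x assume "x \<in> vars r"
    \<comment> \<open>As \<open>l\<close> is headed by a constructor, \<open>x\<close> sits inside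
      an argument of \<open>l\<close>, so its value is a subterm of a normal argument.\<close>
    then obtain l' where l': "l' \<in> set ls" "x \<in> vars l'" using vars_r rule(2) by auto
    then have "subst \<eta> l' \<in> set ts" using l\<eta> rule(2) by auto
    moreover from this have "subst \<eta> l' \<in> well_sorted \<Gamma>"
      using ground by (fastforce simp: ground_terms_def well_sorted_def list_all2_conv_all_nth in_set_conv_nth)
    ultimately show "nf (\<eta> x)" using nf nf_subterm subterm_subst_var[OF l'(2)] by blast
  qed
  ultimately show ?thesis by blast
qed

lemma nf_Con:
  assumes "\<forall>t \<in> set ts. nf t" "\<And>l r \<theta>. (l, r) \<in> R \<Longrightarrow> subst \<theta> l \<noteq> Con C ts"
  shows "nf (Con C ts)"
proof -
  have False if "step (Con C ts) u" for u
    using that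
  proof cases
    case (root l r \<theta>)
    then show False using assms(2) by metis
  next
    case (ctxt s t us vs)
    then show False using assms(1) by (auto simp: nf_def)
  qed
  then show ?thesis by (auto simp: nf_def)
qed

text \<open>Minimality pins down the clause but not the matcher, hence the existential over
  \<open>\<theta>\<close>.\<close>

lemma returns_iff_first_clause:
  assumes "i < length (P C)" "fires (P C ! i) ts \<theta>\<^sub>0" "\<forall>j < i. \<nexists>\<theta>. fires (P C ! j) ts \<theta>"
  shows "returns P C ts u \<longleftrightarrow> (\<exists>\<theta>. fires (P C ! i) ts \<theta> \<and> evaluates P \<theta> (body (P C ! i)) u)"
proof
  assume "returns P C ts u"
  then show "\<exists>\<theta>. fires (P C ! i) ts \<theta> \<and> evaluates P \<theta> (body (P C ! i)) u"
  proof cases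
    case (first_clause j \<theta>)
    then have "j = i" using assms by (metis linorder_neqE_nat)
    with first_clause show ?thesis by blast
  qed
qed (use assms in \<open>auto intro: first_clause\<close>)

text \<open>Induction along \<open>below\<close>. The clause order decides only which applicable
  rule rewrites the root; the invariant holds for every choice.\<close>

theorem evaluates_calls_ex:
  "Con C ts \<in> ground_terms \<Gamma> (cdt_sort \<Gamma>) \<Longrightarrow> \<exists>u. evaluates_calls C ts u"
proof (induction "Con C ts" arbitrary: C ts rule: wfp_induct_rule[OF wfp_below[OF wfp_step]])
  case (1 C ts)
  then have C: "C \<in> constructors \<Gamma>" and len: "length ts = length (profile \<Gamma> C)"
    by (auto simp: ground_terms_def list_all2_lengthD)
  obtain rs cls where rs: "set rs = {(l, r) \<in> R. \<exists>ls. l = Con C ls}"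
    and cls: "list_all2 rule_clause rs cls" and PC: "P C = cls @ [default_clause \<Gamma> C]"
    using program C by (auto simp: generated_program_def)
  have "\<exists>i. i < length (P C) \<and> (\<exists>\<theta>. fires (P C ! i) ts \<theta>)"
  proof (intro exI conjI)
    show "length cls < length (P C)" by (simp add: PC)
    show "fires (P C ! length cls) ts (\<lambda>x. ts ! fst x)"
      using default_clause_fires[OF len] by (simp add: PC)
  qed
  then obtain i where i: "i < length (P C)" "\<exists>\<theta>. fires (P C ! i) ts \<theta>"
    and least': "\<forall>j < i. \<not> (j < length (P C) \<and> (\<exists>\<theta>. fires (P C ! j) ts \<theta>))"
    by (subst (asm) exists_least_iff) blast
  have least: "\<forall>j < i. \<nexists>\<theta>. fires (P C ! j) ts \<theta>"
    using least' less_trans[OF _ i(1)] by blast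
  from i(2) obtain \<theta>\<^sub>0 where \<theta>\<^sub>0: "fires (P C ! i) ts \<theta>\<^sub>0" by blast
  have "\<exists>u. (\<forall>\<theta>. fires (P C ! i) ts \<theta> \<longrightarrow> (\<forall>u'. evaluates P \<theta> (body (P C ! i)) u' \<longleftrightarrow> u' = u)) \<and>
      steps (Con C ts) u \<and> ((\<forall>t \<in> set ts. nf t) \<longrightarrow> nf u)"
  proof (cases "i < length cls")
    case True
    then have PCi: "P C ! i = cls ! i" by (simp add: PC nth_append)
    obtain l r where lr: "rs ! i = (l, r)" by fastforce
    have i_rs: "i < length rs" using True list_all2_lengthD[OF cls] by simp
    have "(l, r) \<in> set rs" "rule_clause (l, r) (cls ! i)"
      using nth_mem[OF i_rs] list_all2_nthD[OF cls i_rs] by (simp_all add: lr)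
    moreover from this(1) obtain ls where "(l, r) \<in> R" "l = Con C ls" using rs by blast
    moreover have "fires (cls ! i) ts \<theta>\<^sub>0" using \<theta>\<^sub>0 PCi by simp
    ultimately show ?thesis unfolding PCi by (intro evaluates_rule_clause[OF 1(1) 1(2)])
  next
    case False
    then have i': "i = length cls" using i(1) by (simp add: PC)
    then have PCi: "P C ! i = default_clause \<Gamma> C" by (simp add: PC)
    \<comment> \<open>A matching rule is headed by \<open>C\<close>, so it owns a clause before the
      default one; that clause would fire, against the minimality of \<open>i\<close>.\<close>
    have "subst \<theta> l \<noteq> Con C ts" if lr: "(l, r) \<in> R" for l r \<theta>
    proof
      assume l: "subst \<theta> l = Con C ts"
      obtain D ls where D: "l = Con D ls" using lhs_Con[OF lr] by blast
      with l lr rs have "(l, r) \<in> set rs" by auto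
      then obtain j where "j < length rs" "rs ! j = (l, r)" by (auto simp: in_set_conv_nth)
      then have "j < length cls" "rule_clause (l, r) (cls ! j)"
        using list_all2_nthD[OF cls, of j] list_all2_lengthD[OF cls] by auto
      then show False
        using rule_clause_fires[OF _ l] least i' by (auto simp: PC nth_append)
    qed
    then have "(\<forall>t \<in> set ts. nf t) \<longrightarrow> nf (Con C ts)" using nf_Con by blast
    then show ?thesis using default_clause_evaluates unfolding PCi by blast
  qed
  then show ?case
    unfolding evaluates_calls_def returns_iff_first_clause[OF i(1) \<theta>\<^sub>0 least]
    using \<theta>\<^sub>0 by blast
qed

section \<open>Values, correctness and completeness\<close>

lemma Con_ground_iff:
  assumes "C \<in> constructors \<Gamma>"
  shows "Con C ts \<in> ground_terms \<Gamma> (cdt_sort \<Gamma>) \<longleftrightarrow> ts \<in> arguments \<Gamma> (ground_terms \<Gamma>) C"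
  using assms by (auto simp: ground_terms_def arguments_def list_all2_conv_all_nth all_set_conv_all_nth)

lemma evaluates_calls_family_of:
  assumes "C \<in> constructors \<Gamma>" "ts \<in> arguments \<Gamma> (ground_terms \<Gamma>) C"
  shows "evaluates_calls C ts (family_of P C ts)"
proof -
  obtain u where u: "evaluates_calls C ts u" using evaluates_calls_ex Con_ground_iff assms by blast
  then have "family_of P C ts = u" by (simp add: evaluates_calls_def family_of_def)
  with u show ?thesis by simp
qed

lemma is_val_nf:
  assumes "cdt_definition \<Gamma>" "is_val \<Gamma> (family_of P) \<sigma> v"
  shows "v \<in> ground_terms \<Gamma> \<sigma> \<and> nf v"
  using assms(2)
proof (induction rule: is_val.induct)
  case (prim \<sigma> t)
  \<comment> \<open>An application has sort \<open>cdt_sort \<Gamma>\<close>, which is not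
    primitive; this leaves only constants, and these are irreducible.\<close>
  then have "\<exists>k. t = Prim k" using assms(1)
    by (cases t) (auto simp: ground_terms_def cdt_definition_def)
  with prim nf_Prim show ?case by auto
next
  case (con C vs)
  then have vs: "vs \<in> arguments \<Gamma> (ground_terms \<Gamma>) C" and "\<forall>v \<in> set vs. nf v"
    by (auto simp: arguments_def list_all2_conv_all_nth all_set_conv_all_nth)
  moreover have "Con C vs \<in> ground_terms \<Gamma> (cdt_sort \<Gamma>)"
    using Con_ground_iff con(1) vs by blast
  ultimately show ?case
    using evaluates_calls_family_of[OF con(1) vs] steps_ground by (auto simp: evaluates_calls_def)
qed

lemma terminating: "terminating \<Gamma> P"
  unfolding terminating_def
proof (intro ballI)
  fix C ts assume C: "C \<in> constructors \<Gamma>" and ts: "ts \<in> arguments \<Gamma> (ground_terms \<Gamma>) C"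
  show "\<exists>!u. returns P C ts u"
    using evaluates_calls_family_of[OF C ts] by (simp add: evaluates_calls_def)
qed

lemma construction_functions: "construction_functions \<Gamma> (family_of P)"
  unfolding construction_functions_def
proof (intro ballI)
  fix C ts assume C: "C \<in> constructors \<Gamma>" and ts: "ts \<in> arguments \<Gamma> (ground_terms \<Gamma>) C"
  have "steps (Con C ts) (family_of P C ts)"
    using evaluates_calls_family_of[OF C ts] unfolding evaluates_calls_def by (elim conjE)
  then show "family_of P C ts \<in> ground_terms \<Gamma> (cdt_sort \<Gamma>)"
    using ts[folded Con_ground_iff[OF C]] by (rule steps_ground)
qed

text \<open>Results are reducts of the applications, which gives correctness. They are also normal,
  so by confluence two results equal in the theory are identical.\<close>

lemma valid_family_of:
  assumes "cdt_definition \<Gamma>" "confluentp step"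
  shows "valid \<Gamma> R (family_of P)"
proof -
  have val: "steps (Con C vs) (family_of P C vs) \<and> nf (family_of P C vs) \<and> Con C vs \<in> well_sorted \<Gamma>"
    if C: "C \<in> constructors \<Gamma>" and vs: "vs \<in> arguments \<Gamma> (Val \<Gamma> (family_of P)) C" for C vs
  proof -
    have "vs \<in> arguments \<Gamma> (ground_terms \<Gamma>) C" "\<forall>v \<in> set vs. nf v"
      using vs is_val_nf[OF assms(1)]
      by (auto simp: arguments_def Val_def list_all2_conv_all_nth all_set_conv_all_nth)
    moreover from this have "Con C vs \<in> well_sorted \<Gamma>"
      using Con_ground_iff[OF C] unfolding ground_terms_def well_sorted_def by blast
    ultimately show ?thesis
      using evaluates_calls_family_of[OF C] by (auto simp: evaluates_calls_def)
  qed
  have "family_of P C vs = family_of P D ws"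
    if "C \<in> constructors \<Gamma>" "vs \<in> arguments \<Gamma> (Val \<Gamma> (family_of P)) C"
      "D \<in> constructors \<Gamma>" "ws \<in> arguments \<Gamma> (Val \<Gamma> (family_of P)) D"
      and eq: "eq_theory \<Gamma> R (Con C vs) (Con D ws)" for C D vs ws
  proof -
    note C = val[OF that(1,2)] and D = val[OF that(3,4)]
    have "eq_theory \<Gamma> R (family_of P C vs) (family_of P D ws)"
      using eq C D eq_theory_steps by (meson eq_theory.sym eq_theory.trans)
    then show ?thesis using eq_theory_joinable[OF assms(2)] C D nf_steps by metis
  qed
  then show ?thesis
    unfolding valid_def using val eq_theory_steps eq_theory.sym by meson
qed

end

section \<open>Rewrite rules of a complete presentation\<close>

lemma rewrite_step_reduction_ordering:
  assumes "reduction_ordering \<Gamma> gt" "R \<subseteq> gt"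
    and "rewrite_step \<Gamma> R s t"
  shows "(s, t) \<in> gt"
  using assms(3)
proof (induction rule: rewrite_step.induct)
  case (root l r \<theta>)
  with assms(2) have "(l, r) \<in> gt" by blast
  with root(2) show ?case using assms(1) by (simp add: reduction_ordering_def)
next
  case (ctxt s t C us vs)
  then show ?case using assms(1) by (simp add: reduction_ordering_def)
qed

lemma reduction_ordering_wfp_step:
  assumes "reduction_ordering \<Gamma> gt" "R \<subseteq> gt"
  shows "wfp (rewrite_step \<Gamma> R)\<inverse>\<inverse>"
proof -
  have "wf (gt\<inverse>)" using assms(1) by (simp add: reduction_ordering_def)
  then have "wf {(s, t). (rewrite_step \<Gamma> R)\<inverse>\<inverse> s t}"
    by (rule wf_subset) (auto intro: rewrite_step_reduction_ordering[OF assms])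
  then show ?thesis by (simp add: wfp_def)
qed

text \<open>Iterating the substitution of \<open>r\<close> for \<open>x\<close> would give an
  infinite descent that starts with \<open>x > r\<close>.\<close>

lemma reduction_ordering_Var_not_greater:
  assumes gt: "reduction_ordering \<Gamma> gt" and sort: "has_sort \<Gamma> (Var x) \<sigma>" "has_sort \<Gamma> r \<sigma>"
  shows "(Var x, r) \<notin> gt"
proof
  assume xr: "(Var x, r) \<in> gt"
  define \<theta> where "\<theta> = Var(x := r)"
  have \<theta>: "sorted_subst \<Gamma> \<theta>" using sort by (auto simp: sorted_subst_def \<theta>_def)
  have "((subst \<theta> ^^ n) (Var x), (subst \<theta> ^^ Suc n) (Var x)) \<in> gt" for n
  proof (induction n)
    case 0
    then show ?case using xr by (simp add: \<theta>_def)
  next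
    case (Suc n)
    then show ?case using gt \<theta> by (auto simp: reduction_ordering_def)
  qed
  then have "\<exists>f. \<forall>n. (f (Suc n), f n) \<in> gt\<inverse>"
    by (intro exI[of _ "\<lambda>n. (subst \<theta> ^^ n) (Var x)"] allI converseI)
  moreover have "wf (gt\<inverse>)" using gt by (simp add: reduction_ordering_def)
  ultimately show False unfolding wf_iff_no_infinite_down_chain by blast
qed

text \<open>Axioms and contexts only produce equations at the defined sort; elsewhere reflexivity is
  all there is.\<close>

lemma eq_theory_trivial_off_cdt_sort:
  assumes "\<forall>(s, t) \<in> E. has_sort \<Gamma> s (cdt_sort \<Gamma>) \<and> has_sort \<Gamma> t (cdt_sort \<Gamma>)"
    and "eq_theory \<Gamma> E s t"
  shows "s = t \<or> has_sort \<Gamma> s (cdt_sort \<Gamma>) \<and> has_sort \<Gamma> t (cdt_sort \<Gamma>)"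
  using assms(2)
proof (induction rule: eq_theory.induct)
  case (ax s t \<theta>)
  then show ?case using assms(1) by (auto intro: has_sort_subst)
qed (auto simp: well_sorted_def)

text \<open>The reduction ordering excludes a variable. A constant is excluded because its rule
  would be an equation of the theory of \<open>E\<close> at a primitive sort, hence an identity,
  while no rule has equal sides.\<close>

lemma complete_presentation_lhs_Con:
  assumes \<Gamma>: "cdt_definition \<Gamma>"
    and E: "\<forall>(s, t) \<in> E. has_sort \<Gamma> s (cdt_sort \<Gamma>) \<and> has_sort \<Gamma> t (cdt_sort \<Gamma>)"
    and R: "complete_presentation \<Gamma> E R"
    and lr: "(l, r) \<in> R"
  shows "\<exists>C ls. l = Con C ls"
proof -
  obtain gt where gt: "reduction_ordering \<Gamma> gt" "R \<subseteq> gt"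
    using R by (auto simp: complete_presentation_def)
  have rule: "rewrite_rule \<Gamma> (l, r)" and eq: "eq_theory \<Gamma> R = eq_theory \<Gamma> E"
    using R lr by (auto simp: complete_presentation_def)
  from rule obtain \<sigma> where \<sigma>: "has_sort \<Gamma> l \<sigma>" "has_sort \<Gamma> r \<sigma>"
    by (auto simp: rewrite_rule_def)
  show ?thesis
  proof (cases l)
    case (Var x)
    then show ?thesis using reduction_ordering_Var_not_greater[OF gt(1)] \<sigma> lr gt(2) by blast
  next
    case (Prim k)
    have "eq_theory \<Gamma> R (subst Var l) (subst Var r)"
      by (rule eq_theory.ax[OF lr]) (auto simp: sorted_subst_def)
    then have "eq_theory \<Gamma> E l r" by (simp add: eq)
    then consider "l = r" | "has_sort \<Gamma> l (cdt_sort \<Gamma>)"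
      using eq_theory_trivial_off_cdt_sort[OF E] by blast
    then show ?thesis
    proof cases
      case 1
      then have "(l, l) \<in> gt\<inverse>" using lr gt(2) by auto
      then show ?thesis using gt(1) by (auto simp: reduction_ordering_def dest: wf_not_refl)
    next
      case 2
      then show ?thesis using Prim \<Gamma> by (auto simp: cdt_definition_def)
    qed
  qed auto
qed

theorem theorem6:
  fixes \<Gamma> :: "('s, 'k, 'c) cdt" and E R :: "('s, 'k, 'c) rule set" and P :: "('s, 'k, 'c) program"
  assumes "cdt_definition \<Gamma>"
    and "finite E"
    and "\<forall>(s, t) \<in> E. has_sort \<Gamma> s (cdt_sort \<Gamma>) \<and> has_sort \<Gamma> t (cdt_sort \<Gamma>)"
    and "AC_equations E = {}"
    and "complete_presentation \<Gamma> E R"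
    and "generated_program \<Gamma> R P"
  shows "terminating \<Gamma> P \<and> construction_functions \<Gamma> (family_of P) \<and> valid \<Gamma> E (family_of P)"
proof -
  obtain gt where gt: "reduction_ordering \<Gamma> gt" "R \<subseteq> gt"
    using assms(5) by (auto simp: complete_presentation_def)
  have eq: "eq_theory \<Gamma> E = eq_theory \<Gamma> R" and confl: "confluentp (rewrite_step \<Gamma> R)"
    using assms(5) by (auto simp: complete_presentation_def)
  interpret generated \<Gamma> R P
  proof
    show "rewrite_rule \<Gamma> lr" if "lr \<in> R" for lr
      using assms(5) that by (auto simp: complete_presentation_def)
    show "\<exists>C ls. l = Con C ls" if "(l, r) \<in> R" for l r
      using complete_presentation_lhs_Con assms(1,3,5) that by blast
  qed (use reduction_ordering_wfp_step[OF gt] assms(6) in auto)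
  \<comment> \<open>Validity refers to the equations only through \<open>eq_theory\<close>, so it
    transfers from \<open>R\<close> to \<open>E\<close>.\<close>
  show ?thesis
    using terminating construction_functions valid_family_of[OF assms(1) confl]
    by (simp add: valid_def eq)
qed

end
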